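(* Let $J$ be a forward kernel on $E=\mathbb{R}\times X$, let $\eta\in[0,\infty)$, and let $Q:\mathbb{R}\times\mathbb{R}\to[0,\infty)$ be super-additive, i.e. $Q(u,r)+Q(r,v)\le Q(u,v)$ for all $u<r<v$. Let $dt=\mu(dt)$ be a $\sigma$-finite, non-atomic (nonnegative) measure on $(\mathbb{R},\mathcal{B}_{\mathbb{R}})$ and $dz=m(dz)$ a $\sigma$-finite measure on $(X,\mathcal{M})$. Let $\kappa(s,x,t,y)\ge0$, $s,t\in\mathbb{R}$, $x,y\in X$, be a forward kernel density, i.e. $\kappa(s,x,t,y)\,dt\,dy$ is a forward kernel on $E$ and $(s,x)\mapsto\kappa(s,x,t,y)$ is jointly measurable for all $t\in\mathbb{R}$, $y\in X$. Let $\kappa_0=\kappa$ and, for $n=1,2,\ldots$, $$\kappa_n(s,x,t,y)=\int_s^t\int_X\kappa_{n-1}(s,x,u,z)\int_{(u,t)\times X}J(u,z,du_1dz_1)\,\kappa(u_1,z_1,t,y)\,dz\,du,$$ and let $\widetilde\kappa=\sum_{n=0}^\infty\kappa_n$. Assume that for all $s<t$ in $\mathbb{R}$ and $x,y\in X$, $$\int_s^t\int_X\kappa(s,x,u,z)\int_{(u,t)\times X}J(u,z,du_1dz_1)\,\kappa(u_1,z_1,t,y)\,dz\,du\le[\eta+Q(s,t)]\,\kappa(s,x,t,y).$$ Then for all $n=1,2,\ldots$, $s<t$ and $x,y\in X$, $$\kappa_n(s,x,t,y)\le\kappa_{n-1}(s,x,t,y)\left[\eta+\frac{Q(s,t)}{n}\right]\le\kappa(s,x,t,y)\prod_{l=1}^n\left[\eta+\frac{Q(s,t)}{l}\right].$$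 If $0<\eta<1$, then for all $s,t\in\mathbb{R}$ and $x,y\in X$, $$\widetilde\kappa(s,x,t,y)\le\kappa(s,x,t,y)\left(\frac{1}{1-\eta}\right)^{1+Q(s,t)/\eta}.$$ If $\eta=0$, then for all $s,t\in\mathbb{R}$ and $x,y\in X$, $$\widetilde\kappa(s,x,t,y)\le\kappa(s,x,t,y)\,e^{Q(s,t)}.$$
   Context: $(X,\mathcal{M})$ is a measurable space, $\mathbb{R}$ carries its Borel $\sigma$-algebra $\mathcal{B}_{\mathbb{R}}$, and $E=\mathbb{R}\times X$ carries the product $\sigma$-algebra $\mathcal{E}=\mathcal{B}_{\mathbb{R}}\times\mathcal{M}$. A kernel on $E$ is a map $K:E\times\mathcal{E}\to[0,\infty]$ such that $(s,x)\mapsto K(s,x,A)$ is $\mathcal{E}$-measurable for every $A\in\mathcal{E}$ and $A\mapsto K(s,x,A)$ is countably additive (a measure) for every $(s,x)\in E$. A kernel $K$ on $E$ is forward if for all $s\in\mathbb{R}$, $x\in X$, $A\in\mathcal{E}$: $K(s,x,A)=0$ whenever $A\subseteq(-\infty,s]\times X$. The symbols $dt,du$ denote integration with respect to $\mu$, and $dy,dz$ integration with respect to $m$ (except that $J(u,z,du_1dz_1)$ is integration in $(u_1,z_1)$ against the measure $J(u,z,\cdot)$); $\int_s^t$ is the integral over $\{u:s<u<t\}$ (zero if $t\le s$).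
   Formalization: Two assumptions are added, without either of which the claim is false: J is a countable sum of kernels of finite mass, and κ(s,x,t,y) is jointly measurable in all four variables (s,x,t,y), not only separately in (s,x) and in (t,y). *)

theory Defs
  imports "HOL-Probability.Probability"
begin

text \<open>
  A kernel on a measurable space \<open>E\<close>. The map \<open>(e, A) \<mapsto> K(e, A)\<close> with values in \<open>[0, \<infinity>]\<close> is
  encoded as a measure-valued function; the value at \<open>(e, A)\<close> is \<open>emeasure (K e) A\<close>.
\<close>

definition is_kernel :: "'a measure \<Rightarrow> ('a \<Rightarrow> 'a measure) \<Rightarrow> bool" where
  "is_kernel E K \<longleftrightarrow>
     (\<forall>e\<in>space E. sets (K e) = sets E) \<and>
     (\<forall>A\<in>sets E. (\<lambda>e. emeasure (K e) A) \<in> borel_measurable E)"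

definition forward_kernel :: "'x measure \<Rightarrow> (real \<times> 'x \<Rightarrow> (real \<times> 'x) measure) \<Rightarrow> bool" where
  "forward_kernel M K \<longleftrightarrow>
     is_kernel (borel \<Otimes>\<^sub>M M) K \<and>
     (\<forall>s. \<forall>x\<in>space M. \<forall>A\<in>sets (borel \<Otimes>\<^sub>M M).
        A \<subseteq> {..s} \<times> space M \<longrightarrow> emeasure (K (s, x)) A = 0)"

text \<open>
  The kernel is a countable sum of kernels with finite (not necessarily bounded) masses. This
  is the regularity under which Tonelli's theorem applies to integrals against \<open>K\<close>.
\<close>

definition s_finite_kernel :: "'a measure \<Rightarrow> ('a \<Rightarrow> 'a measure) \<Rightarrow> bool" where
  "s_finite_kernel E K \<longleftrightarrow>
     (\<exists>F :: nat \<Rightarrow> 'a \<Rightarrow> 'a measure.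
        (\<forall>i. is_kernel E (F i) \<and> (\<forall>e\<in>space E. emeasure (F i e) (space E) < \<infinity>)) \<and>
        (\<forall>e\<in>space E. \<forall>A\<in>sets E. emeasure (K e) A = (\<Sum>i. emeasure (F i e) A)))"

definition non_atomic :: "'a measure \<Rightarrow> bool" where
  "non_atomic \<mu> \<longleftrightarrow>
     (\<forall>A\<in>sets \<mu>. emeasure \<mu> A > 0 \<longrightarrow>
        (\<exists>B\<in>sets \<mu>. B \<subseteq> A \<and> 0 < emeasure \<mu> B \<and> emeasure \<mu> B < emeasure \<mu> A))"

definition super_additive :: "(real \<Rightarrow> real \<Rightarrow> real) \<Rightarrow> bool" where
  "super_additive Q \<longleftrightarrow> (\<forall>u r v. u < r \<and> r < v \<longrightarrow> Q u r + Q r v \<le> Q u v)"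

text \<open>
  The first conjunct is what makes \<open>\<kappa>(s, x, t, y) dt dy\<close> meaningful: \<open>density\<close> has the intended
  values only for measurable functions.
\<close>

definition forward_kernel_density ::
  "'x measure \<Rightarrow> real measure \<Rightarrow> 'x measure \<Rightarrow> (real \<Rightarrow> 'x \<Rightarrow> real \<Rightarrow> 'x \<Rightarrow> ennreal) \<Rightarrow> bool" where
  "forward_kernel_density M \<mu> m \<kappa> \<longleftrightarrow>
     (\<forall>s. \<forall>x\<in>space M. (\<lambda>(t, y). \<kappa> s x t y) \<in> borel_measurable (borel \<Otimes>\<^sub>M M)) \<and>
     forward_kernel M (\<lambda>(s, x). density (\<mu> \<Otimes>\<^sub>M m) (\<lambda>(t, y). \<kappa> s x t y)) \<and>
     (\<forall>t. \<forall>y\<in>space M. (\<lambda>(s, x). \<kappa> s x t y) \<in> borel_measurable (borel \<Otimes>\<^sub>M M))"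

definition compose_J ::
  "real measure \<Rightarrow> 'x measure \<Rightarrow> (real \<times> 'x \<Rightarrow> (real \<times> 'x) measure) \<Rightarrow>
   (real \<Rightarrow> 'x \<Rightarrow> real \<Rightarrow> 'x \<Rightarrow> ennreal) \<Rightarrow> (real \<Rightarrow> 'x \<Rightarrow> real \<Rightarrow> 'x \<Rightarrow> ennreal) \<Rightarrow>
   real \<Rightarrow> 'x \<Rightarrow> real \<Rightarrow> 'x \<Rightarrow> ennreal" where
  "compose_J \<mu> m J \<phi> \<kappa> s x t y =
     (\<integral>\<^sup>+ u \<in> {s<..<t}.
        (\<integral>\<^sup>+ z. \<phi> s x u z *
           (\<integral>\<^sup>+ e \<in> {u<..<t} \<times> space m. \<kappa> (fst e) (snd e) t y \<partial>(J (u, z))) \<partial>m) \<partial>\<mu>)"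

primrec kappa_n ::
  "real measure \<Rightarrow> 'x measure \<Rightarrow> (real \<times> 'x \<Rightarrow> (real \<times> 'x) measure) \<Rightarrow>
   (real \<Rightarrow> 'x \<Rightarrow> real \<Rightarrow> 'x \<Rightarrow> ennreal) \<Rightarrow> nat \<Rightarrow> real \<Rightarrow> 'x \<Rightarrow> real \<Rightarrow> 'x \<Rightarrow> ennreal" where
  "kappa_n \<mu> m J \<kappa> 0 = \<kappa>"
| "kappa_n \<mu> m J \<kappa> (Suc n) = compose_J \<mu> m J (kappa_n \<mu> m J \<kappa> n) \<kappa>"

definition kappa_tilde ::
  "real measure \<Rightarrow> 'x measure \<Rightarrow> (real \<times> 'x \<Rightarrow> (real \<times> 'x) measure) \<Rightarrow>
   (real \<Rightarrow> 'x \<Rightarrow> real \<Rightarrow> 'x \<Rightarrow> ennreal) \<Rightarrow> real \<Rightarrow> 'x \<Rightarrow> real \<Rightarrow> 'x \<Rightarrow> ennreal" where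
  "kappa_tilde \<mu> m J \<kappa> s x t y = (\<Sum>n. kappa_n \<mu> m J \<kappa> n s x t y)"

end

theory Submission
  imports Defs
begin

text \<open>
  The density \<open>\<kappa>\<^sub>n\<^sub>+\<^sub>1(s, x, t, y)\<close> is estimated in two ways, with \<open>u\<close> the last time at which \<open>\<kappa>\<^sub>n\<^sub>-\<^sub>1\<close> is
  evaluated. Applying the induction hypothesis to \<open>\<kappa>\<^sub>n\<close> inside the integral produces the factor
  \<open>\<eta> + Q(s, u) / n\<close>. Regrouping by Tonelli's theorem and applying the assumed bound to the last two
  copies of \<open>\<kappa>\<close> produces the factor \<open>\<eta> + Q(u, t)\<close>. Adding \<open>n\<close> times the first estimate to the
  second, super-additivity gives \<open>(n + 1) \<kappa>\<^sub>n\<^sub>+\<^sub>1 \<le> ((n + 1) \<eta> + Q(s, t)) \<kappa>\<^sub>n\<close>. The resulting products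
  sum to the binomial series for \<open>(1 - \<eta>)\<close> to the power \<open>- (1 + Q / \<eta>)\<close>, or to the exponential
  series when \<open>\<eta> = 0\<close>.
\<close>

section \<open>Integration against s-finite kernels\<close>

text \<open>Both sides are additive, homogeneous and continuous along increasing sequences in
  \<open>f\<close>, so induction over nonnegative measurable functions reduces the claim to
  indicators, where it is \<open>emeasure_F\<close>.\<close>

lemma nn_integral_countable_sum_measure:
  assumes sets_F: "\<And>i. sets (F i) = sets N"
    and emeasure_F: "\<And>A. A \<in> sets N \<Longrightarrow> emeasure N A = (\<Sum>i::nat. emeasure (F i) A)"
    and f: "f \<in> borel_measurable N"
  shows "integral\<^sup>N N f = (\<Sum>i. integral\<^sup>N (F i) f)"
  using f
proof (induction rule: borel_measurable_induct)
  case (cong f g)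
  have "space (F i) = space N" for i
    using sets_F by (rule sets_eq_imp_space_eq)
  with cong(3) have "integral\<^sup>N (F i) f = integral\<^sup>N (F i) g" for i
    by (intro nn_integral_cong) simp
  moreover have "integral\<^sup>N N f = integral\<^sup>N N g"
    using cong(3) by (rule nn_integral_cong)
  ultimately show ?case
    using cong(4) by simp
next
  case (set A)
  then show ?case
    by (simp add: emeasure_F sets_F)
next
  case (mult u c)
  then have "u \<in> borel_measurable (F i)" for i
    using sets_F by (simp cong: measurable_cong_sets)
  with mult show ?case
    by (simp add: nn_integral_cmult)
next
  case (add u v)
  then have "u \<in> borel_measurable (F i)" "v \<in> borel_measurable (F i)" for i
    using sets_F by (simp_all cong: measurable_cong_sets)
  with add show ?case
    by (simp add: nn_integral_add suminf_add)
next
  case (seq U)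
  have U: "U n \<in> borel_measurable (F i)" for n i
    using sets_F seq by (simp cong: measurable_cong_sets)
  have "integral\<^sup>N N (\<lambda>x. SUP n. U n x) = (SUP n. integral\<^sup>N N (U n))"
    using seq by (intro nn_integral_monotone_convergence_SUP) auto
  also have "\<dots> = (SUP n. \<Sum>i. integral\<^sup>N (F i) (U n))"
    using seq by simp
  also have "\<dots> = (\<Sum>i. SUP n. integral\<^sup>N (F i) (U n))"
    using seq(3) by (intro ennreal_suminf_SUP_eq[symmetric])
      (auto simp: incseq_def le_fun_def intro!: nn_integral_mono)
  also have "\<dots> = (\<Sum>i. integral\<^sup>N (F i) (\<lambda>x. SUP n. U n x))"
    using seq U by (simp add: nn_integral_monotone_convergence_SUP)
  finally show ?case
    by (simp add: SUP_apply[abs_def])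
qed

lemma finite_kernel_nn_integral_measurable:
  assumes K: "is_kernel E K"
    and fin: "\<And>e. e \<in> space E \<Longrightarrow> emeasure (K e) (space E) < \<infinity>"
    and f[measurable]: "(\<lambda>(x, y). f x y) \<in> borel_measurable (E \<Otimes>\<^sub>M N)"
    and g[measurable]: "g \<in> measurable N E"
  shows "(\<lambda>y. \<integral>\<^sup>+ x. f x y \<partial>K (g y)) \<in> borel_measurable N"
proof -
  \<comment> \<open>The masses need not be bounded, so \<open>K\<close> is rescaled pointwise to a subprobability kernel \<open>L\<close>;
    the added \<open>1\<close> avoids dividing by zero.\<close>
  define c where "c e = 1 + emeasure (K e) (space E)" for e
  define L where "L e = scale_measure (inverse (c e)) (K e)" for e
  have sets_K: "sets (K e) = sets E" if "e \<in> space E" for e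
    using K that by (simp add: is_kernel_def)
  have [measurable]: "(\<lambda>e. emeasure (K e) A) \<in> borel_measurable E" if "A \<in> sets E" for A
    using K that by (simp add: is_kernel_def)
  have c[measurable]: "c \<in> borel_measurable E"
    unfolding c_def by measurable
  \<comment> \<open>Cancellation in \<open>ennreal\<close> fails at infinity as well as at 0;
    finiteness of \<open>c e\<close> comes from \<open>fin\<close>.\<close>
  have c_inv: "c e * inverse (c e) = 1" if "e \<in> space E" for e
    using fin[OF that] unfolding c_def
    by (intro ennreal_divide_self[unfolded divide_ennreal_def]) auto
  have L[measurable]: "L \<in> measurable E (subprob_algebra E)"
  proof (rule measurable_subprob_algebra)
    fix e assume e: "e \<in> space E"
    have sp: "space (K e) = space E"
      by (rule sets_eq_imp_space_eq) (rule sets_K[OF e])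
    show "subprob_space (L e)"
    proof (rule subprob_spaceI)
      have "inverse (c e) * emeasure (K e) (space E) \<le> inverse (c e) * c e"
        by (intro mult_left_mono) (auto simp: c_def)
      also have "\<dots> = 1"
        using c_inv[OF e] by (simp add: mult.commute)
      finally show "emeasure (L e) (space (L e)) \<le> 1"
        by (simp add: L_def sp space_scale_measure)
      show "space (L e) \<noteq> {}"
        using e by (auto simp: L_def sp space_scale_measure)
    qed
    show "sets (L e) = sets E"
      by (simp add: L_def sets_K[OF e])
  next
    fix A assume [measurable]: "A \<in> sets E"
    show "(\<lambda>e. emeasure (L e) A) \<in> borel_measurable E"
      unfolding L_def emeasure_scale_measure by measurable
  qed
  have "(\<integral>\<^sup>+ x. f x y \<partial>K (g y)) = c (g y) * (\<integral>\<^sup>+ x. f x y \<partial>L (g y))" if y: "y \<in> space N" for y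
  proof -
    have gy: "g y \<in> space E"
      using measurable_space[OF g y] .
    have "(\<lambda>x. f x y) \<in> borel_measurable E"
      using y by measurable
    then have "(\<lambda>x. f x y) \<in> borel_measurable (K (g y))"
      using sets_K[OF gy] by (simp cong: measurable_cong_sets)
    then have "c (g y) * (\<integral>\<^sup>+ x. f x y \<partial>L (g y))
        = (c (g y) * inverse (c (g y))) * (\<integral>\<^sup>+ x. f x y \<partial>K (g y))"
      by (simp add: L_def nn_integral_scale_measure mult.assoc)
    then show ?thesis
      by (simp add: c_inv[OF gy])
  qed
  moreover have "(\<lambda>y. c (g y) * (\<integral>\<^sup>+ x. f x y \<partial>L (g y))) \<in> borel_measurable N"
  proof -
    have "(\<lambda>y. \<integral>\<^sup>+ x. f x y \<partial>L (g y)) \<in> borel_measurable N"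
      by (rule nn_integral_measurable_subprob_algebra2[where N = E]) measurable
    then show ?thesis
      by measurable
  qed
  ultimately show ?thesis
    by (simp cong: measurable_cong)
qed

text \<open>Lifts the decomposition in \<open>s_finite_kernel\<close> from sets to integrals, the
  form in which it is used below.\<close>

lemma s_finite_kernelE:
  assumes K: "is_kernel E K" "s_finite_kernel E K"
  obtains F :: "nat \<Rightarrow> 'a \<Rightarrow> 'a measure" where
    "\<And>i. is_kernel E (F i)"
    "\<And>i e. e \<in> space E \<Longrightarrow> emeasure (F i e) (space E) < \<infinity>"
    "\<And>e f. e \<in> space E \<Longrightarrow> f \<in> borel_measurable E \<Longrightarrow>
       (\<integral>\<^sup>+ x. f x \<partial>K e) = (\<Sum>i. \<integral>\<^sup>+ x. f x \<partial>F i e)"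
proof -
  obtain F :: "nat \<Rightarrow> 'a \<Rightarrow> 'a measure" where
    F: "\<And>i. is_kernel E (F i)"
      "\<And>i e. e \<in> space E \<Longrightarrow> emeasure (F i e) (space E) < \<infinity>"
      "\<And>e A. e \<in> space E \<Longrightarrow> A \<in> sets E \<Longrightarrow> emeasure (K e) A = (\<Sum>i. emeasure (F i e) A)"
    using K(2) unfolding s_finite_kernel_def by blast
  have "(\<integral>\<^sup>+ x. f x \<partial>K e) = (\<Sum>i. \<integral>\<^sup>+ x. f x \<partial>F i e)"
    if e: "e \<in> space E" and f: "f \<in> borel_measurable E" for e f
  proof (rule nn_integral_countable_sum_measure)
    have sets_K: "sets (K e) = sets E"
      using K(1) e by (simp add: is_kernel_def)
    then show "sets (F i e) = sets (K e)" for i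
      using F(1)[of i] e by (simp add: is_kernel_def)
    show "emeasure (K e) A = (\<Sum>i. emeasure (F i e) A)" if "A \<in> sets (K e)" for A
      using that sets_K F(3)[OF e] by simp
    show "f \<in> borel_measurable (K e)"
      using f sets_K by (simp cong: measurable_cong_sets)
  qed
  with F(1,2) that show thesis
    by blast
qed

text \<open>The base point \<open>g y\<close> of the kernel and the parameter of the integrand vary
  together, as joint measurability of \<open>hop\<close> requires. A countable sum of the finite
  case suffices.\<close>

lemma s_finite_kernel_nn_integral_measurable:
  assumes K: "is_kernel E K" "s_finite_kernel E K"
    and f[measurable]: "(\<lambda>(x, y). f x y) \<in> borel_measurable (E \<Otimes>\<^sub>M N)"
    and g[measurable]: "g \<in> measurable N E"
  shows "(\<lambda>y. \<integral>\<^sup>+ x. f x y \<partial>K (g y)) \<in> borel_measurable N"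
proof -
  obtain F :: "nat \<Rightarrow> 'a \<Rightarrow> 'a measure" where
    F: "\<And>i. is_kernel E (F i)"
      "\<And>i e. e \<in> space E \<Longrightarrow> emeasure (F i e) (space E) < \<infinity>"
      "\<And>e f. e \<in> space E \<Longrightarrow> f \<in> borel_measurable E \<Longrightarrow>
         (\<integral>\<^sup>+ x. f x \<partial>K e) = (\<Sum>i. \<integral>\<^sup>+ x. f x \<partial>F i e)"
    using s_finite_kernelE[OF K] by blast
  have "(\<integral>\<^sup>+ x. f x y \<partial>K (g y)) = (\<Sum>i. \<integral>\<^sup>+ x. f x y \<partial>F i (g y))" if "y \<in> space N" for y
    using that by (intro F(3)) (auto intro: measurable_space[OF g])
  moreover have [measurable]: "(\<lambda>y. \<integral>\<^sup>+ x. f x y \<partial>F i (g y)) \<in> borel_measurable N" for i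
    by (rule finite_kernel_nn_integral_measurable[OF F(1,2) f g])
  ultimately show ?thesis
    by (simp cong: measurable_cong)
qed

text \<open>The measure \<open>K e\<close> need not be sigma-finite, but each summand
  \<open>F i e\<close> is finite. Fubini's theorem therefore applies term by term, and the sum
  passes through the integral over \<open>P\<close> by nonnegativity.\<close>

lemma s_finite_kernel_Tonelli:
  assumes K: "is_kernel E K" "s_finite_kernel E K" and e: "e \<in> space E"
    and P: "sigma_finite_measure P"
    and f[measurable]: "(\<lambda>(p, x). f p x) \<in> borel_measurable (P \<Otimes>\<^sub>M E)"
  shows "(\<integral>\<^sup>+ p. \<integral>\<^sup>+ x. f p x \<partial>K e \<partial>P) = (\<integral>\<^sup>+ x. \<integral>\<^sup>+ p. f p x \<partial>P \<partial>K e)"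
proof -
  interpret P: sigma_finite_measure P by (fact P)
  obtain F :: "nat \<Rightarrow> 'a \<Rightarrow> 'a measure" where
    F: "\<And>i. is_kernel E (F i)"
      "\<And>i e. e \<in> space E \<Longrightarrow> emeasure (F i e) (space E) < \<infinity>"
      "\<And>e f. e \<in> space E \<Longrightarrow> f \<in> borel_measurable E \<Longrightarrow>
         (\<integral>\<^sup>+ x. f x \<partial>K e) = (\<Sum>i. \<integral>\<^sup>+ x. f x \<partial>F i e)"
    using s_finite_kernelE[OF K] by blast
  have sets_F[measurable_cong]: "sets (F i e) = sets E" for i
    using F(1)[of i] e by (simp add: is_kernel_def)
  have finite_F: "finite_measure (F i e)" for i
    using F(2)[OF e, of i] sets_eq_imp_space_eq[OF sets_F[of i]]
    by (intro finite_measureI) auto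
  have [measurable]: "(\<lambda>(x, p). f p x) \<in> borel_measurable (E \<Otimes>\<^sub>M P)"
    by measurable
  have "(\<integral>\<^sup>+ p. \<integral>\<^sup>+ x. f p x \<partial>K e \<partial>P) = (\<integral>\<^sup>+ p. (\<Sum>i. \<integral>\<^sup>+ x. f p x \<partial>F i e) \<partial>P)"
    by (intro nn_integral_cong F(3)[OF e]) measurable
  also have "\<dots> = (\<Sum>i. \<integral>\<^sup>+ p. \<integral>\<^sup>+ x. f p x \<partial>F i e \<partial>P)"
  proof (intro nn_integral_suminf)
    fix i
    interpret finite_measure "F i e" by (fact finite_F)
    show "(\<lambda>p. \<integral>\<^sup>+ x. f p x \<partial>F i e) \<in> borel_measurable P"
      by measurable
  qed
  also have "\<dots> = (\<Sum>i. \<integral>\<^sup>+ x. \<integral>\<^sup>+ p. f p x \<partial>P \<partial>F i e)"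
  proof (intro suminf_cong)
    fix i
    interpret finite_measure "F i e" by (fact finite_F)
    interpret pair_sigma_finite "F i e" P ..
    show "(\<integral>\<^sup>+ p. \<integral>\<^sup>+ x. f p x \<partial>F i e \<partial>P) = (\<integral>\<^sup>+ x. \<integral>\<^sup>+ p. f p x \<partial>P \<partial>F i e)"
      by (rule Fubini') measurable
  qed
  also have "\<dots> = (\<integral>\<^sup>+ x. \<integral>\<^sup>+ p. f p x \<partial>P \<partial>K e)"
    by (intro F(3)[OF e, symmetric]) measurable
  finally show ?thesis .
qed

section \<open>Binomial and exponential series\<close>

text \<open>With \<open>a = 1 + q / \<eta>\<close> each factor is
  \<open>\<eta> + q / l = \<eta> * (a + l - 1) / l\<close>, so the products are the terms of the
  binomial series of \<open>(1 + x) powr (- a)\<close> at \<open>x = - \<eta>\<close>.\<close>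

lemma sums_prod_binomial:
  fixes q :: real
  assumes "0 < \<eta>" "\<eta> < 1"
  shows "(\<lambda>n. \<Prod>l=1..n. \<eta> + q / real l) sums (1 / (1 - \<eta>)) powr (1 + q / \<eta>)"
proof -
  define a where "a = 1 + q / \<eta>"
  have "((- a) gchoose n) * (- \<eta>) ^ n = (\<Prod>l=1..n. \<eta> + q / real l)" for n
  proof (induction n)
    case (Suc n)
    have "((- a) gchoose Suc n) * (- \<eta>) ^ Suc n
        = (((- a) gchoose n) * (- \<eta>) ^ n) * (\<eta> * (a + real n) / real (Suc n))"
      by (simp add: gbinomial_pochhammer pochhammer_Suc mult_ac)
    also have "\<eta> * (a + real n) / real (Suc n) = \<eta> + q / real (Suc n)"
      using assms by (simp add: a_def divide_simps) (simp add: algebra_simps)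
    finally show ?case
      by (simp add: Suc)
  qed simp
  moreover have "(1 + - \<eta>) powr (- a) = (1 / (1 - \<eta>)) powr a"
    using assms by (simp add: powr_minus inverse_powr divide_inverse)
  ultimately show ?thesis
    using gen_binomial_real[of "- \<eta>" "- a"] assms by (simp add: a_def)
qed

text \<open>The products are \<open>q ^ n / fact n\<close>. This serves the case
  \<open>\<eta> = 0\<close>, where the exponent \<open>1 + q / \<eta>\<close> has no
  meaning.\<close>

lemma sums_prod_exp:
  fixes q :: real
  shows "(\<lambda>n. \<Prod>l=1..n. q / real l) sums exp q"
proof -
  have "(\<Prod>l=1..n. q / real l) = q ^ n /\<^sub>R fact n" for n
    by (simp add: prod_dividef fact_prod) (simp add: divide_inverse mult.commute)
  then show ?thesis
    using exp_converges[of q] by simp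
qed

section \<open>The iterates as repeated convolutions on space-time\<close>

text \<open>Gathers what the interchange of integrals rests on: s-finiteness of \<open>J\<close>,
  sigma-finiteness of \<open>\<mu>\<close> and \<open>m\<close>, and joint measurability of
  \<open>\<kappa>\<close> in all four variables.\<close>

locale jump_perturbation =
  fixes M :: "'x measure" and \<mu> :: "real measure" and m :: "'x measure"
    and J :: "real \<times> 'x \<Rightarrow> (real \<times> 'x) measure"
    and \<kappa> :: "real \<Rightarrow> 'x \<Rightarrow> real \<Rightarrow> 'x \<Rightarrow> ennreal"
  assumes J_kernel: "is_kernel (borel \<Otimes>\<^sub>M M) J"
    and J_s_finite: "s_finite_kernel (borel \<Otimes>\<^sub>M M) J"
    and sets_mu[measurable_cong]: "sets \<mu> = sets borel"
    and sigma_finite_mu: "sigma_finite_measure \<mu>"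
    and sets_m[measurable_cong]: "sets m = sets M"
    and sigma_finite_m: "sigma_finite_measure m"
    and kappa_measurable: "(\<lambda>((s, x), (t, y)). \<kappa> s x t y)
          \<in> borel_measurable ((borel \<Otimes>\<^sub>M M) \<Otimes>\<^sub>M (borel \<Otimes>\<^sub>M M))"
begin

sublocale mu: sigma_finite_measure \<mu> by (fact sigma_finite_mu)
sublocale m: sigma_finite_measure m by (fact sigma_finite_m)
sublocale P: pair_sigma_finite \<mu> m ..

abbreviation E :: "(real \<times> 'x) measure" where "E \<equiv> borel \<Otimes>\<^sub>M M"
abbreviation P :: "(real \<times> 'x) measure" where "P \<equiv> \<mu> \<Otimes>\<^sub>M m"

text \<open>Time and space are paired so that each double integral over them becomes one integral
  over \<open>P\<close>.\<close>

abbreviation \<kappa>n :: "nat \<Rightarrow> real \<times> 'x \<Rightarrow> real \<times> 'x \<Rightarrow> ennreal" where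
  "\<kappa>n n a b \<equiv> kappa_n \<mu> m J \<kappa> n (fst a) (snd a) (fst b) (snd b)"

text \<open>The inner factor of the recursion: a jump from \<open>a\<close> by \<open>J\<close>,
  then propagation by \<open>\<kappa>\<close> to \<open>b\<close>, with the landing time strictly
  between those of \<open>a\<close> and \<open>b\<close>.\<close>

definition hop :: "real \<times> 'x \<Rightarrow> real \<times> 'x \<Rightarrow> ennreal" where
  "hop a b = (\<integral>\<^sup>+ e. \<kappa>n 0 e b * indicator {fst a<..<fst b} (fst e) \<partial>J a)"

text \<open>One step of the recursion as an operator on functions of the end point. Of the starting
  point only the time \<open>s\<close> remains, as the lower limit, so the operator can be
  iterated.\<close>

definition conv :: "real \<Rightarrow> (real \<times> 'x \<Rightarrow> ennreal) \<Rightarrow> real \<times> 'x \<Rightarrow> ennreal" where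
  "conv s \<phi> b = (\<integral>\<^sup>+ c. \<phi> c * hop c b * indicator {s<..<fst b} (fst c) \<partial>P)"

lemma sets_P[measurable_cong]: "sets P = sets E"
  by (simp add: sets_mu sets_m cong: sets_pair_measure_cong)

lemma space_m: "space m = space M"
  using sets_m by (rule sets_eq_imp_space_eq)

lemma space_P: "space P = space E"
  using sets_P by (rule sets_eq_imp_space_eq)

lemma sets_J: "a \<in> space E \<Longrightarrow> sets (J a) = sets E"
  using J_kernel by (simp add: is_kernel_def)

lemma space_J: "a \<in> space E \<Longrightarrow> space (J a) = space E"
  using sets_J by (rule sets_eq_imp_space_eq)

lemma k_measurable[measurable (raw)]:
  assumes [measurable]: "f \<in> measurable N E" "g \<in> measurable N E"
  shows "(\<lambda>x. \<kappa>n 0 (f x) (g x)) \<in> borel_measurable N"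
proof -
  have "(\<lambda>x. (\<lambda>((s, x), (t, y)). \<kappa> s x t y) (f x, g x)) \<in> borel_measurable N"
    by (rule measurable_compose[OF _ kappa_measurable]) measurable
  then show ?thesis
    by (simp add: case_prod_unfold)
qed

text \<open>Needed because the time intervals in \<open>hop\<close> and \<open>conv\<close> move
  with the integration variables.\<close>

lemma indicator_Ioo_measurable[measurable (raw)]:
  fixes f g h :: "'b \<Rightarrow> real"
  assumes [measurable]: "f \<in> borel_measurable N" "g \<in> borel_measurable N" "h \<in> borel_measurable N"
  shows "(\<lambda>x. indicator {f x<..<g x} (h x) :: ennreal) \<in> borel_measurable N"
  unfolding indicator_def greaterThanLessThan_iff by measurable

lemma hop_measurable[measurable (raw)]:
  assumes [measurable]: "f \<in> measurable N E" "g \<in> measurable N E"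
  shows "(\<lambda>x. hop (f x) (g x)) \<in> borel_measurable N"
  unfolding hop_def
  by (rule s_finite_kernel_nn_integral_measurable[OF J_kernel J_s_finite]) measurable

lemma conv_measurable[measurable (raw)]:
  assumes [measurable]: "(\<lambda>(x, c). \<phi> x c) \<in> borel_measurable (N \<Otimes>\<^sub>M E)"
    "f \<in> borel_measurable N" "g \<in> measurable N E"
  shows "(\<lambda>x. conv (f x) (\<phi> x) (g x)) \<in> borel_measurable N"
  unfolding conv_def by measurable

lemma compose_J_eq_conv:
  assumes [measurable]: "(\<lambda>c. \<phi> s x (fst c) (snd c)) \<in> borel_measurable E"
    and y: "y \<in> space M"
  shows "compose_J \<mu> m J \<phi> \<kappa> s x t y = conv s (\<lambda>c. \<phi> s x (fst c) (snd c)) (t, y)"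
proof -
  have [measurable]: "(t, y) \<in> space E"
    using y by (simp add: space_pair_measure)
  \<comment> \<open>For \<open>z\<close> in the space, \<open>J (u, z)\<close> lives on
    \<open>E\<close>, so the spatial half of the product set is no restriction and the condition on
    time alone remains.\<close>
  have hop: "(\<integral>\<^sup>+ e \<in> {u<..<t} \<times> space m. \<kappa> (fst e) (snd e) t y \<partial>(J (u, z))) = hop (u, z) (t, y)"
    if "z \<in> space m" for u z
    unfolding hop_def
  proof (rule nn_integral_cong)
    fix e assume "e \<in> space (J (u, z))"
    then have "snd e \<in> space m"
      using that by (subst (asm) space_J) (auto simp: space_pair_measure space_m)
    then show "\<kappa> (fst e) (snd e) t y * indicator ({u<..<t} \<times> space m) e
        = \<kappa>n 0 e (t, y) * indicator {fst (u, z)<..<fst (t, y)} (fst e)"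
      by (auto simp: indicator_def mem_Times_iff)
  qed
  have "compose_J \<mu> m J \<phi> \<kappa> s x t y
      = (\<integral>\<^sup>+ u. \<integral>\<^sup>+ z. \<phi> s x u z * hop (u, z) (t, y) * indicator {s<..<t} u \<partial>m \<partial>\<mu>)"
    unfolding compose_J_def
  proof (rule nn_integral_cong)
    fix u
    have [measurable]: "(\<lambda>z. (u, z)) \<in> measurable m E"
      by measurable
    have "(\<lambda>z. \<phi> s x (fst (u, z)) (snd (u, z))) \<in> borel_measurable m"
      by measurable
    then have [measurable]: "\<phi> s x u \<in> borel_measurable m"
      by simp
    show "(\<integral>\<^sup>+ z. \<phi> s x u z * (\<integral>\<^sup>+ e \<in> {u<..<t} \<times> space m. \<kappa> (fst e) (snd e) t y \<partial>(J (u, z))) \<partial>m)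
          * indicator {s<..<t} u
        = (\<integral>\<^sup>+ z. \<phi> s x u z * hop (u, z) (t, y) * indicator {s<..<t} u \<partial>m)"
      by (subst nn_integral_multc) (auto simp: hop cong: nn_integral_cong)
  qed
  also have "\<dots> = conv s (\<lambda>c. \<phi> s x (fst c) (snd c)) (t, y)"
    unfolding conv_def by (subst m.nn_integral_fst[symmetric]) auto
  finally show ?thesis .
qed

text \<open>The recursion turns into \<open>conv\<close> only once the current iterate is known to
  be measurable. The identity of \<open>kn_Suc\<close> is therefore derived inside this induction
  first.\<close>

lemma kn_measurable:
  assumes "a \<in> space E"
  shows "(\<lambda>b. \<kappa>n n a b) \<in> borel_measurable E"
proof (induction n)
  case 0
  show ?case
    using assms by measurable
next
  case (Suc n)
  note [measurable] = Suc
  have "\<kappa>n (Suc n) a b = conv (fst a) (\<kappa>n n a) b" if "b \<in> space E" for b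
    using compose_J_eq_conv[of "kappa_n \<mu> m J \<kappa> n" "fst a" "snd a" "snd b" "fst b", OF Suc] that
    by (auto simp: space_pair_measure)
  moreover have "(\<lambda>b. conv (fst a) (\<kappa>n n a) b) \<in> borel_measurable E"
    by measurable
  ultimately show ?case
    by (simp cong: measurable_cong del: kappa_n.simps)
qed

lemma kn_Suc:
  assumes "a \<in> space E" "b \<in> space E"
  shows "\<kappa>n (Suc n) a b = conv (fst a) (\<kappa>n n a) b"
  using compose_J_eq_conv[of "kappa_n \<mu> m J \<kappa> n" "fst a" "snd a" "snd b" "fst b",
      OF kn_measurable[OF assms(1)]] assms(2)
  by (auto simp: space_pair_measure)

section \<open>Regrouping two steps of the recursion\<close>

text \<open>An associativity law. A path runs from \<open>d\<close> by a jump to \<open>e\<close>,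
  by \<open>\<kappa>\<close> to \<open>c\<close>, and by \<open>hop\<close> to \<open>b\<close>;
  integrating over \<open>c\<close> before \<open>e\<close> joins the last two copies of
  \<open>\<kappa>\<close> into the first iterate from \<open>e\<close> to \<open>b\<close>, to which
  the assumed bound applies.\<close>

lemma conv_conv:
  assumes [measurable]: "\<phi> \<in> borel_measurable E" and b[measurable]: "b \<in> space E"
  shows "conv s (conv s \<phi>) b =
    (\<integral>\<^sup>+ d. \<phi> d * (\<integral>\<^sup>+ e. conv (fst e) (\<kappa>n 0 e) b * indicator {fst d<..<fst b} (fst e) \<partial>J d)
       * indicator {s<..<fst b} (fst d) \<partial>P)"
proof -
  interpret PP: pair_sigma_finite P P ..
  have hop_hop: "(\<integral>\<^sup>+ c. hop d c * hop c b * indicator {fst d<..<fst b} (fst c) \<partial>P)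
      = (\<integral>\<^sup>+ e. conv (fst e) (\<kappa>n 0 e) b * indicator {fst d<..<fst b} (fst e) \<partial>J d)"
    if d[measurable]: "d \<in> space E" for d
  proof -
    note sets_J[OF d, measurable_cong]
    let ?f = "\<lambda>c e. \<kappa>n 0 e c * indicator {fst d<..<fst c} (fst e) *
      (hop c b * indicator {fst d<..<fst b} (fst c))"
    have "(\<integral>\<^sup>+ c. hop d c * hop c b * indicator {fst d<..<fst b} (fst c) \<partial>P)
        = (\<integral>\<^sup>+ c. \<integral>\<^sup>+ e. ?f c e \<partial>J d \<partial>P)"
    proof (rule nn_integral_cong)
      fix c assume "c \<in> space P"
      then have [measurable]: "c \<in> space E" by (simp add: space_P)
      show "hop d c * hop c b * indicator {fst d<..<fst b} (fst c) = (\<integral>\<^sup>+ e. ?f c e \<partial>J d)"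
        by (subst nn_integral_multc, measurable) (simp only: hop_def mult.assoc)
    qed
    also have "\<dots> = (\<integral>\<^sup>+ e. \<integral>\<^sup>+ c. ?f c e \<partial>P \<partial>J d)"
      by (rule s_finite_kernel_Tonelli[OF J_kernel J_s_finite d P.sigma_finite_measure_axioms])
        measurable
    also have "\<dots> = (\<integral>\<^sup>+ e. conv (fst e) (\<kappa>n 0 e) b * indicator {fst d<..<fst b} (fst e) \<partial>J d)"
    proof (rule nn_integral_cong)
      fix e assume "e \<in> space (J d)"
      then have [measurable]: "e \<in> space E" by (simp add: space_J d)
      have "conv (fst e) (\<kappa>n 0 e) b * indicator {fst d<..<fst b} (fst e)
          = (\<integral>\<^sup>+ c. \<kappa>n 0 e c * hop c b * indicator {fst e<..<fst b} (fst c)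
               * indicator {fst d<..<fst b} (fst e) \<partial>P)"
        unfolding conv_def by (subst nn_integral_multc) measurable
      \<comment> \<open>Both products of indicators encode the chain
        \<open>fst d < fst e < fst c < fst b\<close>.\<close>
      also have "\<dots> = (\<integral>\<^sup>+ c. ?f c e \<partial>P)"
        by (intro nn_integral_cong) (auto simp: indicator_def)
      finally show "(\<integral>\<^sup>+ c. ?f c e \<partial>P)
          = conv (fst e) (\<kappa>n 0 e) b * indicator {fst d<..<fst b} (fst e)" ..
    qed
    finally show ?thesis .
  qed
  let ?g = "\<lambda>c d. \<phi> d * indicator {s<..<fst b} (fst d) *
    (hop d c * hop c b * indicator {fst d<..<fst b} (fst c))"
  have "conv s (conv s \<phi>) b = (\<integral>\<^sup>+ c. \<integral>\<^sup>+ d. ?g c d \<partial>P \<partial>P)"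
    unfolding conv_def[of s "conv s \<phi>"]
  proof (rule nn_integral_cong)
    fix c assume "c \<in> space P"
    then have [measurable]: "c \<in> space E" by (simp add: space_P)
    have "conv s \<phi> c * hop c b * indicator {s<..<fst b} (fst c)
        = (\<integral>\<^sup>+ d. \<phi> d * hop d c * indicator {s<..<fst c} (fst d)
             * (hop c b * indicator {s<..<fst b} (fst c)) \<partial>P)"
      unfolding conv_def by (subst nn_integral_multc, measurable) (simp only: mult.assoc)
    \<comment> \<open>Both products of indicators encode \<open>s < fst d < fst c < fst b\<close>;
      in \<open>?g\<close> the factors that depend on \<open>d\<close> alone stand apart, ready to
      leave the integral over \<open>c\<close>.\<close>
    also have "\<dots> = (\<integral>\<^sup>+ d. ?g c d \<partial>P)"
      by (intro nn_integral_cong) (auto simp: indicator_def mult_ac)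
    finally show "conv s \<phi> c * hop c b * indicator {s<..<fst b} (fst c) = (\<integral>\<^sup>+ d. ?g c d \<partial>P)" .
  qed
  also have "\<dots> = (\<integral>\<^sup>+ d. \<integral>\<^sup>+ c. ?g c d \<partial>P \<partial>P)"
    by (rule PP.Fubini') measurable
  also have "\<dots> = (\<integral>\<^sup>+ d. \<phi> d * (\<integral>\<^sup>+ e. conv (fst e) (\<kappa>n 0 e) b
       * indicator {fst d<..<fst b} (fst e) \<partial>J d) * indicator {s<..<fst b} (fst d) \<partial>P)"
  proof (rule nn_integral_cong)
    fix d assume "d \<in> space P"
    then have d[measurable]: "d \<in> space E" by (simp add: space_P)
    have "(\<integral>\<^sup>+ c. ?g c d \<partial>P) = \<phi> d * indicator {s<..<fst b} (fst d)
        * (\<integral>\<^sup>+ c. hop d c * hop c b * indicator {fst d<..<fst b} (fst c) \<partial>P)"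
      by (subst nn_integral_cmult) measurable
    then show "(\<integral>\<^sup>+ c. ?g c d \<partial>P) = \<phi> d * (\<integral>\<^sup>+ e. conv (fst e) (\<kappa>n 0 e) b
       * indicator {fst d<..<fst b} (fst e) \<partial>J d) * indicator {s<..<fst b} (fst d)"
      unfolding hop_hop[OF d] by (simp only: mult_ac)
  qed
  finally show ?thesis .
qed

section \<open>The inductive estimate\<close>

text \<open>The end point \<open>b\<close> stays free in the induction because the hypothesis is
  applied at intermediate points \<open>c\<close>. Iterates may be infinite, so the two estimates
  are only added, and a positive finite factor is cancelled at the end.\<close>

lemma kn_Suc_le:
  fixes Q :: "real \<Rightarrow> real \<Rightarrow> real"
  assumes eta: "0 \<le> \<eta>" and Q_nonneg: "\<And>s t. 0 \<le> Q s t" and Q_super: "super_additive Q"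
    and bound: "\<And>a b. a \<in> space E \<Longrightarrow> b \<in> space E \<Longrightarrow> fst a < fst b \<Longrightarrow>
      \<kappa>n 1 a b \<le> ennreal (\<eta> + Q (fst a) (fst b)) * \<kappa>n 0 a b"
    and "a \<in> space E" "b \<in> space E" "fst a < fst b"
  shows "\<kappa>n (Suc n) a b \<le> \<kappa>n n a b * ennreal (\<eta> + Q (fst a) (fst b) / real (Suc n))"
  using assms(5-7)
proof (induction n arbitrary: b)
  case 0
  then show ?case
    using bound[of a b] by (simp add: mult.commute)
next
  case (Suc n)
  note a = \<open>a \<in> space E\<close> and b = \<open>b \<in> space E\<close> and ab = \<open>fst a < fst b\<close>
  note [measurable] = a b kn_measurable[OF a]
  have Q_add: "Q u r + Q r v \<le> Q u v" if "u < r" "r < v" for u r v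
    using Q_super that by (simp add: super_additive_def)
  \<comment> \<open>Measurability of \<open>Q\<close> is not assumed, but \<open>Q (fst a)\<close> is nondecreasing on the interval between
    \<open>fst a\<close> and \<open>fst b\<close>, and \<open>q\<close> extends it monotonically to the line.\<close>
  define q where "q u = (if u \<le> fst a then 0 else if u < fst b then Q (fst a) u
    else Q (fst a) (fst b))" for u
  have "mono q"
  proof (rule monoI)
    fix u v :: real assume "u \<le> v"
    show "q u \<le> q v"
    proof (cases "u = v")
      case False
      then show ?thesis
        using \<open>u \<le> v\<close> Q_add[of "fst a" u v] Q_add[of "fst a" u "fst b"] Q_nonneg[of u v]
          Q_nonneg[of u "fst b"] Q_nonneg[of "fst a" v] Q_nonneg[of "fst a" "fst b"]
        by (auto simp: q_def)
    qed simp
  qed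
  then have [measurable]: "q \<in> borel_measurable borel"
    by (rule borel_measurable_mono)
  have q_nonneg: "0 \<le> q u" and q_le: "q u \<le> Q (fst a) (fst b)" for u
    using Q_nonneg[of "fst a" u] Q_nonneg[of "fst a" "fst b"] Q_add[of "fst a" u "fst b"]
      Q_nonneg[of u "fst b"] by (auto simp: q_def)
  \<comment> \<open>The integrand whose integral is \<open>\<kappa>n (Suc n) a b\<close>; both
    estimates are weighted integrals of it.\<close>
  define f where "f c = \<kappa>n n a c * hop c b * indicator {fst a<..<fst b} (fst c)" for c
  have [measurable]: "f \<in> borel_measurable E"
    unfolding f_def by measurable
  let ?L = "\<kappa>n (Suc (Suc n)) a b" and ?q = "Q (fst a) (fst b)"

  \<comment> \<open>The last \<open>hop\<close> stays intact and the induction hypothesis bounds the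
    iterate from \<open>a\<close> to \<open>c\<close>.\<close>
  have last_jump: "?L \<le> (\<integral>\<^sup>+ c. f c * ennreal (\<eta> + q (fst c) / real (Suc n)) \<partial>P)"
    unfolding kn_Suc[OF a b] conv_def
  proof (rule nn_integral_mono)
    fix c assume "c \<in> space P"
    then have c: "c \<in> space E" by (simp add: space_P)
    show "\<kappa>n (Suc n) a c * hop c b * indicator {fst a<..<fst b} (fst c)
        \<le> f c * ennreal (\<eta> + q (fst c) / real (Suc n))"
    proof (cases "fst a < fst c \<and> fst c < fst b")
      case True
      then have "\<kappa>n (Suc n) a c \<le> \<kappa>n n a c * ennreal (\<eta> + q (fst c) / real (Suc n))"
        using Suc.IH[OF a c] by (simp add: q_def del: kappa_n.simps)
      from mult_right_mono[OF this, of "hop c b"] show ?thesis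
        using True by (simp add: f_def mult_ac del: kappa_n.simps)
    qed (auto simp: indicator_def)
  qed

  \<comment> \<open>After regrouping, the bound is applied to the final piece from \<open>e\<close>
    to \<open>b\<close>. Its factor is replaced by one independent of \<open>e\<close>, which leaves
    the integral over \<open>J d\<close>; what remains there is \<open>hop d b\<close>.\<close>
  have first_jump: "?L \<le> (\<integral>\<^sup>+ c. f c * ennreal (\<eta> + ?q - q (fst c)) \<partial>P)"
  proof -
    have "?L = conv (fst a) (conv (fst a) (\<kappa>n n a)) b"
      unfolding kn_Suc[OF a b] unfolding conv_def[of "fst a" _ b]
      by (intro nn_integral_cong) (simp only: kn_Suc[OF a] space_P)
    also have "\<dots> = (\<integral>\<^sup>+ d. \<kappa>n n a d * (\<integral>\<^sup>+ e. \<kappa>n 1 e b * indicator {fst d<..<fst b} (fst e) \<partial>J d)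
        * indicator {fst a<..<fst b} (fst d) \<partial>P)"
      unfolding conv_conv[OF kn_measurable[OF a] b] One_nat_def
      by (intro nn_integral_cong arg_cong2[where f = "(*)"] refl)
        (simp only: space_P space_J kn_Suc[OF _ b])
    also have "\<dots> \<le> (\<integral>\<^sup>+ c. f c * ennreal (\<eta> + ?q - q (fst c)) \<partial>P)"
    proof (rule nn_integral_mono)
      fix d assume "d \<in> space P"
      then have d[measurable]: "d \<in> space E" by (simp add: space_P)
      note sets_J[OF d, measurable_cong]
      show "\<kappa>n n a d * (\<integral>\<^sup>+ e. \<kappa>n 1 e b * indicator {fst d<..<fst b} (fst e) \<partial>J d)
          * indicator {fst a<..<fst b} (fst d) \<le> f d * ennreal (\<eta> + ?q - q (fst d))"
      proof (cases "fst a < fst d \<and> fst d < fst b")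
        case True
        have "(\<integral>\<^sup>+ e. \<kappa>n 1 e b * indicator {fst d<..<fst b} (fst e) \<partial>J d)
            \<le> (\<integral>\<^sup>+ e. ennreal (\<eta> + ?q - q (fst d)) * (\<kappa>n 0 e b * indicator {fst d<..<fst b} (fst e)) \<partial>J d)"
        proof (rule nn_integral_mono)
          fix e assume "e \<in> space (J d)"
          then have e: "e \<in> space E" by (simp add: space_J d)
          show "\<kappa>n 1 e b * indicator {fst d<..<fst b} (fst e)
              \<le> ennreal (\<eta> + ?q - q (fst d)) * (\<kappa>n 0 e b * indicator {fst d<..<fst b} (fst e))"
          proof (cases "fst d < fst e \<and> fst e < fst b")
            case e_mid: True
            \<comment> \<open>Super-additivity is used twice, splitting the interval from
              \<open>a\<close> to \<open>b\<close> at \<open>d\<close> and then the rest at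
              \<open>e\<close>; the part from \<open>d\<close> to \<open>e\<close> is dropped by
              nonnegativity.\<close>
            have "q (fst d) = Q (fst a) (fst d)"
              using True by (simp add: q_def)
            then have "Q (fst e) (fst b) \<le> ?q - q (fst d)"
              using Q_add[of "fst d" "fst e" "fst b"] Q_add[of "fst a" "fst d" "fst b"]
                Q_nonneg[of "fst d" "fst e"] True e_mid by linarith
            then have "ennreal (\<eta> + Q (fst e) (fst b)) \<le> ennreal (\<eta> + ?q - q (fst d))"
              by (intro ennreal_leI) simp
            then have "\<kappa>n 1 e b \<le> ennreal (\<eta> + ?q - q (fst d)) * \<kappa>n 0 e b"
              using bound[OF e b] e_mid by (meson mult_right_mono order_trans zero_le)
            then show ?thesis
              using e_mid by simp
          qed (auto simp: indicator_def)
        qed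
        also have "\<dots> = ennreal (\<eta> + ?q - q (fst d)) * hop d b"
          unfolding hop_def by (rule nn_integral_cmult) measurable
        finally have "\<kappa>n n a d * (\<integral>\<^sup>+ e. \<kappa>n 1 e b * indicator {fst d<..<fst b} (fst e) \<partial>J d)
            \<le> \<kappa>n n a d * (ennreal (\<eta> + ?q - q (fst d)) * hop d b)"
          by (rule mult_left_mono) simp
        then show ?thesis
          using True by (simp add: f_def mult_ac)
      qed (auto simp: indicator_def)
    qed
    finally show ?thesis .
  qed

  have kn_f: "\<kappa>n (Suc n) a b = (\<integral>\<^sup>+ c. f c \<partial>P)"
    by (simp only: kn_Suc[OF a b] conv_def f_def)
  \<comment> \<open>The weights \<open>Suc n\<close> and \<open>1\<close> are chosen so that
    \<open>q (fst c)\<close> cancels in the sum of the two factors.\<close>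
  have "ennreal (real (Suc (Suc n))) * ?L = ennreal (real (Suc n)) * ?L + ?L"
    by (subst of_nat_Suc, subst ennreal_plus) (auto simp: distrib_right add.commute)
  also have "\<dots> \<le> ennreal (real (Suc n)) * (\<integral>\<^sup>+ c. f c * ennreal (\<eta> + q (fst c) / real (Suc n)) \<partial>P)
      + (\<integral>\<^sup>+ c. f c * ennreal (\<eta> + ?q - q (fst c)) \<partial>P)"
    by (intro add_mono mult_left_mono last_jump first_jump) simp
  also have "\<dots> = (\<integral>\<^sup>+ c. ennreal (real (Suc n)) * (f c * ennreal (\<eta> + q (fst c) / real (Suc n)))
      + f c * ennreal (\<eta> + ?q - q (fst c)) \<partial>P)"
    by (subst nn_integral_add, measurable, subst nn_integral_cmult, measurable)
  also have "\<dots> = (\<integral>\<^sup>+ c. f c * ennreal (real (Suc (Suc n)) * (\<eta> + ?q / real (Suc (Suc n)))) \<partial>P)"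
  proof (rule nn_integral_cong)
    fix c :: "real \<times> 'x"
    \<comment> \<open>Since \<open>ennreal\<close> sends negative reals to 0, merging the summands
      requires \<open>\<eta> + ?q - q (fst c)\<close> to be nonnegative, hence
      \<open>q_le\<close>.\<close>
    have "ennreal (real (Suc n)) * ennreal (\<eta> + q (fst c) / real (Suc n)) + ennreal (\<eta> + ?q - q (fst c))
        = ennreal (real (Suc n) * (\<eta> + q (fst c) / real (Suc n)) + (\<eta> + ?q - q (fst c)))"
      using eta q_nonneg[of "fst c"] q_le[of "fst c"]
      by (simp add: ennreal_mult ennreal_plus del: of_nat_Suc)
    also have "real (Suc n) * (\<eta> + q (fst c) / real (Suc n)) + (\<eta> + ?q - q (fst c))
        = real (Suc (Suc n)) * (\<eta> + ?q / real (Suc (Suc n)))"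
      by (simp add: field_simps)
    finally show "ennreal (real (Suc n)) * (f c * ennreal (\<eta> + q (fst c) / real (Suc n)))
        + f c * ennreal (\<eta> + ?q - q (fst c))
        = f c * ennreal (real (Suc (Suc n)) * (\<eta> + ?q / real (Suc (Suc n))))"
      by (metis distrib_left mult.left_commute)
  qed
  also have "\<dots> = \<kappa>n (Suc n) a b * ennreal (real (Suc (Suc n)) * (\<eta> + ?q / real (Suc (Suc n))))"
    unfolding kn_f by (rule nn_integral_multc) measurable
  also have "\<dots> = ennreal (real (Suc (Suc n))) * (\<kappa>n (Suc n) a b * ennreal (\<eta> + ?q / real (Suc (Suc n))))"
    using eta Q_nonneg by (subst ennreal_mult) (auto simp: mult_ac)
  finally show ?case
    by (subst (asm) ennreal_mult_le_mult_iff) (auto simp del: kappa_n.simps)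
qed

end

section \<open>Summation of the series and the final bounds\<close>

lemma kappa_tilde_le:
  assumes bound: "\<And>n. kappa_n \<mu> m J \<kappa> n s x t y \<le> \<kappa> s x t y * ennreal (c n)"
    and nonneg: "\<And>n. 0 \<le> c n" and sums: "c sums S"
  shows "kappa_tilde \<mu> m J \<kappa> s x t y \<le> \<kappa> s x t y * ennreal S"
proof -
  have "kappa_tilde \<mu> m J \<kappa> s x t y \<le> (\<Sum>n. \<kappa> s x t y * ennreal (c n))"
    unfolding kappa_tilde_def by (intro suminf_le bound) auto
  also have "\<dots> = \<kappa> s x t y * (\<Sum>n. ennreal (c n))"
    by simp
  also have "(\<Sum>n. ennreal (c n)) = ennreal S"
    by (rule suminf_ennreal_eq[OF nonneg sums])
  finally show ?thesis .
qed

theorem theorem2p4: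
  fixes M :: "'x measure"
    and \<mu> :: "real measure"
    and m :: "'x measure"
    and J :: "real \<times> 'x \<Rightarrow> (real \<times> 'x) measure"
    and \<kappa> :: "real \<Rightarrow> 'x \<Rightarrow> real \<Rightarrow> 'x \<Rightarrow> ennreal"
    and Q :: "real \<Rightarrow> real \<Rightarrow> real"
    and \<eta> :: real
  assumes J: "forward_kernel M J"
    and J_s_finite: "s_finite_kernel (borel \<Otimes>\<^sub>M M) J"
    and eta: "0 \<le> \<eta>"
    and Q_nonneg: "\<And>s t. 0 \<le> Q s t"
    and Q_super: "super_additive Q"
    and mu: "sets \<mu> = sets borel" "sigma_finite_measure \<mu>" "non_atomic \<mu>"
    and m: "sets m = sets M" "sigma_finite_measure m"
    and kappa: "forward_kernel_density M \<mu> m \<kappa>"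
    and kappa_joint: "(\<lambda>((s, x), (t, y)). \<kappa> s x t y)
                        \<in> borel_measurable ((borel \<Otimes>\<^sub>M M) \<Otimes>\<^sub>M (borel \<Otimes>\<^sub>M M))"
    and bound: "\<And>s t x y. s < t \<Longrightarrow> x \<in> space M \<Longrightarrow> y \<in> space M \<Longrightarrow>
                  compose_J \<mu> m J \<kappa> \<kappa> s x t y \<le> ennreal (\<eta> + Q s t) * \<kappa> s x t y"
  shows "(\<forall>n\<ge>1. \<forall>s t. \<forall>x\<in>space M. \<forall>y\<in>space M. s < t \<longrightarrow>
            kappa_n \<mu> m J \<kappa> n s x t y
              \<le> kappa_n \<mu> m J \<kappa> (n - 1) s x t y * ennreal (\<eta> + Q s t / real n) \<and>
            kappa_n \<mu> m J \<kappa> (n - 1) s x t y * ennreal (\<eta> + Q s t / real n)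
              \<le> \<kappa> s x t y * ennreal (\<Prod>l=1..n. \<eta> + Q s t / real l))
       \<and> (0 < \<eta> \<and> \<eta> < 1 \<longrightarrow>
            (\<forall>s t. \<forall>x\<in>space M. \<forall>y\<in>space M.
               kappa_tilde \<mu> m J \<kappa> s x t y
                 \<le> \<kappa> s x t y * ennreal ((1 / (1 - \<eta>)) powr (1 + Q s t / \<eta>))))
       \<and> (\<eta> = 0 \<longrightarrow>
            (\<forall>s t. \<forall>x\<in>space M. \<forall>y\<in>space M.
               kappa_tilde \<mu> m J \<kappa> s x t y \<le> \<kappa> s x t y * ennreal (exp (Q s t))))"
proof -
  interpret jump_perturbation M \<mu> m J \<kappa>
    by unfold_locales
      (use J J_s_finite mu m kappa_joint in \<open>auto simp: forward_kernel_def sigma_finite_measure_def\<close>)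
  let ?c = "\<lambda>n s t. \<Prod>l=1..n. \<eta> + Q s t / real l"
  have c_nonneg: "0 \<le> ?c n s t" for n s t
    using eta Q_nonneg by (intro prod_nonneg) auto
  have step: "kappa_n \<mu> m J \<kappa> (Suc n) s x t y
      \<le> kappa_n \<mu> m J \<kappa> n s x t y * ennreal (\<eta> + Q s t / real (Suc n))"
    if "s < t" "x \<in> space M" "y \<in> space M" for n s t x y
    using kn_Suc_le[OF eta Q_nonneg Q_super, of "(s, x)" "(t, y)" n] that bound
    by (force simp: space_pair_measure)
  \<comment> \<open>Serves twice: as the induction step of \<open>prod_bound\<close> and as the
    second inequality of the claim.\<close>
  have mult_step: "k * ennreal (\<eta> + Q s t / real (Suc n)) \<le> \<kappa> s x t y * ennreal (?c (Suc n) s t)"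
    if "k \<le> \<kappa> s x t y * ennreal (?c n s t)" for k n s t x y
  proof -
    have "\<kappa> s x t y * ennreal (?c (Suc n) s t)
        = \<kappa> s x t y * ennreal (?c n s t) * ennreal (\<eta> + Q s t / real (Suc n))"
      using c_nonneg[of s t n] by (simp add: ennreal_mult' mult.assoc del: of_nat_Suc)
    then show ?thesis
      using mult_right_mono[OF that] by simp
  qed
  have prod_bound: "kappa_n \<mu> m J \<kappa> n s x t y \<le> \<kappa> s x t y * ennreal (?c n s t)"
    if "s < t" "x \<in> space M" "y \<in> space M" for n s t x y
  proof (induction n)
    case (Suc n)
    show ?case
      by (rule order_trans[OF step[OF that] mult_step[OF Suc]])
  qed simp
  \<comment> \<open>The time interval of integration is empty here, so every iterate beyond the
    zeroth vanishes. The zeroth, \<open>\<kappa>\<close> itself, need not.\<close>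
  have tilde_diag: "kappa_tilde \<mu> m J \<kappa> s x t y = \<kappa> s x t y" if "t \<le> s" for s t x y
  proof -
    have "kappa_n \<mu> m J \<kappa> n s x t y = (if n = 0 then \<kappa> s x t y else 0)" for n
      using that by (cases n) (auto simp: compose_J_def)
    then show ?thesis
      using suminf_finite[of "{0::nat}" "\<lambda>n. kappa_n \<mu> m J \<kappa> n s x t y"]
      by (simp add: kappa_tilde_def)
  qed
  have tilde: "kappa_tilde \<mu> m J \<kappa> s x t y \<le> \<kappa> s x t y * ennreal S"
    if sums: "(\<lambda>n. ?c n s t) sums S" and xy: "x \<in> space M" "y \<in> space M" for s t x y S
  proof (cases "s < t")
    case True
    then show ?thesis
      by (intro kappa_tilde_le[OF prod_bound c_nonneg sums] xy)
  next
    case False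
    \<comment> \<open>The term at \<open>n = 0\<close> is an empty product, so \<open>S\<close> is
      at least 1. This settles \<open>t \<le> s\<close>, where the series reduces to
      \<open>\<kappa>\<close>.\<close>
    have "(\<Sum>n<1. ?c n s t) \<le> S"
      using sum_le_suminf[OF sums_summable[OF sums], of "{..<1}"] c_nonneg sums_unique[OF sums]
      by simp
    then have "\<kappa> s x t y * 1 \<le> \<kappa> s x t y * ennreal S"
      by (intro mult_left_mono) auto
    then show ?thesis
      using False by (simp add: tilde_diag)
  qed
  show ?thesis
  proof (intro conjI impI allI ballI)
    fix n :: nat and s t :: real and x y :: 'x
    assume n: "1 \<le> n" and *: "x \<in> space M" "y \<in> space M" "s < t"
    then obtain k where k: "n = Suc k"
      by (cases n) auto
    show "kappa_n \<mu> m J \<kappa> n s x t y \<le> kappa_n \<mu> m J \<kappa> (n - 1) s x t y * ennreal (\<eta> + Q s t / real n)"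
      using step[OF *(3,1,2), of k] k by simp
    show "kappa_n \<mu> m J \<kappa> (n - 1) s x t y * ennreal (\<eta> + Q s t / real n) \<le> \<kappa> s x t y * ennreal (?c n s t)"
      using mult_step[OF prod_bound[OF *(3,1,2), of k]] k by simp
  next
    fix s t :: real and x y :: 'x
    assume "0 < \<eta> \<and> \<eta> < 1" and xy: "x \<in> space M" "y \<in> space M"
    then show "kappa_tilde \<mu> m J \<kappa> s x t y
        \<le> \<kappa> s x t y * ennreal ((1 / (1 - \<eta>)) powr (1 + Q s t / \<eta>))"
      by (intro tilde sums_prod_binomial) auto
  next
    fix s t :: real and x y :: 'x
    assume "\<eta> = 0" and xy: "x \<in> space M" "y \<in> space M"
    then show "kappa_tilde \<mu> m J \<kappa> s x t y \<le> \<kappa> s x t y * ennreal (exp (Q s t))"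
      using sums_prod_exp[of "Q s t"] by (intro tilde) auto
  qed
qed

end
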